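(* Let $\Delta$ be a pure simplicial complex on $n$ vertices and let $d=\dim\Delta+1$. If $I_\Delta^{(m)}=I_\Delta^m$ for some $m\ge d+1$, then $n\le 2d$.
   Context: Let $K$ be a field and $R=K[x_1,\dots,x_n]$. A simplicial complex $\Delta$ on the vertex set $[n]=\{1,\dots,n\}$ is assumed to satisfy $\{i\}\in\Delta$ for every $i\in[n]$. A facet is a maximal face; $\mathcal F(\Delta)$ is the set of facets; $\Delta$ is pure if all facets have the same dimension. The Stanley-Reisner ideal is $I_\Delta=(x_{i_1}\cdots x_{i_s} : \{i_1,\dots,i_s\}\notin\Delta)$. The $m$-th symbolic power is $I_\Delta^{(m)}=\bigcap_{F\in\mathcal F(\Delta)}P_F^m$, where $P_F=(x_i : i\notin F)$. *)

theory Defs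
  imports Complex_Main "HOL-Library.Poly_Mapping" "HOL-Library.Cardinality"
begin

text \<open>
  The vertex set is \<open>UNIV :: 'v set\<close> for a finite type \<open>'v\<close>, so \<open>n = CARD('v)\<close>. An element of
  \<open>('v, 'k) mpoly\<close> sends each exponent vector to its coefficient; the product of poly mappings is
  convolution, hence for a field \<open>'k\<close> this type is \<open>K[x\<^sub>1, ..., x\<^sub>n]\<close>.
\<close>

type_synonym ('v, 'k) mpoly = "('v \<Rightarrow>\<^sub>0 nat) \<Rightarrow>\<^sub>0 'k"

definition Var :: "'v \<Rightarrow> ('v, 'k::field) mpoly"
  where "Var i = Poly_Mapping.single (Poly_Mapping.single i 1) 1"

text \<open>Ideals of a commutative ring are its submodules over itself.\<close>

lemma module_times: "module ((*) :: 'a::comm_ring_1 \<Rightarrow> 'a \<Rightarrow> 'a)"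
  by unfold_locales (simp_all add: algebra_simps)

definition ideal_gen :: "'a::comm_ring_1 set \<Rightarrow> 'a set"
  where "ideal_gen S = module.span (*) S"

primrec ideal_power :: "'a::comm_ring_1 set \<Rightarrow> nat \<Rightarrow> 'a set"
  where
    "ideal_power I 0 = UNIV"
  | "ideal_power I (Suc m) = ideal_gen {a * b | a b. a \<in> I \<and> b \<in> ideal_power I m}"

definition simplicial_complex :: "'v set set \<Rightarrow> bool"
  where "simplicial_complex \<Delta> \<longleftrightarrow>
    (\<forall>F\<in>\<Delta>. \<forall>G. G \<subseteq> F \<longrightarrow> G \<in> \<Delta>) \<and> (\<forall>i. {i} \<in> \<Delta>)"

definition facets :: "'v set set \<Rightarrow> 'v set set"
  where "facets \<Delta> = {F \<in> \<Delta>. \<forall>G\<in>\<Delta>. F \<subseteq> G \<longrightarrow> G = F}"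

text \<open>Dimensions are integers because the empty face has dimension \<open>-1\<close>.\<close>

definition face_dim :: "'v set \<Rightarrow> int"
  where "face_dim F = int (card F) - 1"

definition complex_dim :: "'v set set \<Rightarrow> int"
  where "complex_dim \<Delta> = Max (face_dim ` \<Delta>)"

definition pure :: "'v set set \<Rightarrow> bool"
  where "pure \<Delta> \<longleftrightarrow> (\<forall>F\<in>facets \<Delta>. \<forall>G\<in>facets \<Delta>. face_dim F = face_dim G)"

definition SR_ideal :: "'v::finite set set \<Rightarrow> ('v, 'k::field) mpoly set"
  where "SR_ideal \<Delta> = ideal_gen {\<Prod>i\<in>\<sigma>. Var i | \<sigma>. \<sigma> \<notin> \<Delta>}"

definition facet_prime :: "'v::finite set \<Rightarrow> ('v, 'k::field) mpoly set"
  where "facet_prime F = ideal_gen {Var i | i. i \<notin> F}"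

text \<open>The symbolic power \<open>I\<^sub>\<Delta>\<^sup>(\<^sup>m\<^sup>)\<close> of the Stanley-Reisner ideal of \<open>\<Delta>\<close>.\<close>

definition SR_symbolic_power :: "'v::finite set set \<Rightarrow> nat \<Rightarrow> ('v, 'k::field) mpoly set"
  where "SR_symbolic_power \<Delta> m = (\<Inter>F\<in>facets \<Delta>. ideal_power (facet_prime F) m)"

end

theory Submission
  imports Defs
begin

text \<open>
  Suppose \<open>n \<ge> 2d + 1\<close>, let \<open>W\<close> be any set of \<open>2d + 1\<close> vertices and \<open>G\<close> a nonface of least
  cardinality \<open>r \<ge> 2\<close>. For \<open>m \<ge> d + 1\<close> consider \<open>u = x\<^sup>W (x\<^sup>G)\<^sup>k\<close> with \<open>k = m - d - 1\<close>. A facet \<open>F\<close>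
  misses at least \<open>d + 1\<close> vertices of \<open>W\<close> and at least one of \<open>G\<close>, so \<open>u\<close> lies in every
  \<open>P\<^sub>F\<^sup>m\<close>. All elements of \<open>I\<^sub>\<Delta>\<^sup>m\<close> have order at least \<open>r m\<close>, whereas
  \<open>deg u = 2d + 1 + r k < r (d + 1) + r k = r m\<close>; so the symbolic and the ordinary power differ.
\<close>

lemma ideal_gen_base: "a \<in> S \<Longrightarrow> a \<in> ideal_gen S"
  unfolding ideal_gen_def by (rule module.span_base[OF module_times])

lemma ideal_gen_mult: "a \<in> ideal_gen S \<Longrightarrow> c * a \<in> ideal_gen S"
  unfolding ideal_gen_def by (rule module.span_scale[OF module_times])

lemma ideal_gen_minimal: "S \<subseteq> J \<Longrightarrow> module.subspace (*) J \<Longrightarrow> ideal_gen S \<subseteq> J"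
  unfolding ideal_gen_def by (rule module.span_minimal[OF module_times])

lemma ideal_power_mult: "a \<in> ideal_power I p \<Longrightarrow> c * a \<in> ideal_power I p"
  by (cases p) (auto intro: ideal_gen_mult)

lemma ideal_power_Suc_mult:
  "a \<in> I \<Longrightarrow> b \<in> ideal_power I p \<Longrightarrow> a * b \<in> ideal_power I (Suc p)"
  by (auto intro: ideal_gen_base)

lemma ideal_power_power_mult:
  assumes "a \<in> I" and "b \<in> ideal_power I p"
  shows "a ^ k * b \<in> ideal_power I (k + p)"
proof (induction k)
  case 0
  show ?case using assms(2) by simp
next
  case (Suc k)
  then show ?case
    using ideal_power_Suc_mult[OF assms(1) Suc.IH] by (simp add: mult.assoc)
qed

lemma ideal_power_prod:
  assumes "finite A" and "\<And>i. i \<in> A \<Longrightarrow> f i \<in> I"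
  shows "(\<Prod>i\<in>A. f i) \<in> ideal_power I (card A)"
  using assms
proof (induction A rule: finite_induct)
  case empty
  then show ?case by simp
next
  case (insert x A)
  then have "f x * (\<Prod>i\<in>A. f i) \<in> ideal_power I (Suc (card A))"
    by (intro ideal_power_Suc_mult) auto
  with insert.hyps show ?case by simp
qed

text \<open>Each \<open>ideal_power I p\<close> is an ideal, so it absorbs the extra factor in the
  generators \<open>a * b\<close> of the next power; the general case follows by iterating this
  step.\<close>

lemma ideal_power_antimono:
  assumes "q \<le> p"
  shows "ideal_power I p \<subseteq> ideal_power I q"
proof -
  have step: "ideal_power I (Suc p) \<subseteq> ideal_power I p" for p
  proof -
    have "module.subspace (*) (ideal_power I p)"
      by (cases p) (simp_all add: ideal_gen_def module.subspace_UNIV[OF module_times]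
          module.subspace_span[OF module_times])
    moreover have "{a * b |a b. a \<in> I \<and> b \<in> ideal_power I p} \<subseteq> ideal_power I p"
      using ideal_power_mult by blast
    ultimately show ?thesis
      unfolding ideal_power.simps(2) by (rule ideal_gen_minimal[rotated])
  qed
  then show ?thesis
    using assms by (rule lift_Suc_antimono_le)
qed

text \<open>Each variable outside \<open>F\<close> contributes one factor from the prime, and those
  inside \<open>F\<close> are absorbed as a multiplier.\<close>

lemma prod_Var_in_facet_prime_power:
  "(\<Prod>i\<in>A. Var i :: ('v::finite, 'k::field) mpoly) \<in> ideal_power (facet_prime F) (card (A - F))"
proof -
  have "(\<Prod>i\<in>A - F. Var i :: ('v, 'k) mpoly) \<in> ideal_power (facet_prime F) (card (A - F))"
    unfolding facet_prime_def by (intro ideal_power_prod) (auto intro: ideal_gen_base)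
  moreover have "(\<Prod>i\<in>A. Var i :: ('v, 'k) mpoly) = (\<Prod>i\<in>A \<inter> F. Var i) * (\<Prod>i\<in>A - F. Var i)"
    by (rule prod.Int_Diff) simp
  ultimately show ?thesis by (simp add: ideal_power_mult)
qed

lemma prod_Var_in_facet_prime:
  assumes "\<not> A \<subseteq> F"
  shows "(\<Prod>i\<in>A. Var i :: ('v::finite, 'k::field) mpoly) \<in> facet_prime F"
proof -
  from assms obtain j where j: "j \<in> A" "j \<notin> F" by auto
  have "(\<Prod>i\<in>A. Var i :: ('v, 'k) mpoly) = (\<Prod>i\<in>A - {j}. Var i) * Var j"
    using j by (subst prod.remove[of _ j]) (auto simp: mult.commute)
  with j show ?thesis
    unfolding facet_prime_def by (auto intro: ideal_gen_mult ideal_gen_base)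
qed

definition exponent_degree :: "('v::finite \<Rightarrow>\<^sub>0 nat) \<Rightarrow> nat"
  where "exponent_degree t = (\<Sum>i\<in>UNIV. Poly_Mapping.lookup t i)"

lemma exponent_degree_zero [simp]: "exponent_degree 0 = 0"
  by (simp add: exponent_degree_def)

lemma exponent_degree_plus: "exponent_degree (s + t) = exponent_degree s + exponent_degree t"
  by (simp add: exponent_degree_def lookup_add sum.distrib)

lemma exponent_degree_single: "exponent_degree (Poly_Mapping.single i e) = e"
  by (simp add: exponent_degree_def lookup_single when_def)

text \<open>The coefficient is fixed to be 1, hence nonzero, so the order of such an
  \<open>f\<close> is exactly \<open>s\<close>.\<close>

definition monomial_of_degree :: "nat \<Rightarrow> ('v::finite, 'k::field) mpoly \<Rightarrow> bool"
  where "monomial_of_degree s f \<longleftrightarrow> (\<exists>t. f = Poly_Mapping.single t 1 \<and> exponent_degree t = s)"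

lemma monomial_of_degree_one: "monomial_of_degree 0 1"
  unfolding monomial_of_degree_def by (rule exI[of _ 0]) simp

lemma monomial_of_degree_mult:
  "monomial_of_degree s f \<Longrightarrow> monomial_of_degree t g \<Longrightarrow> monomial_of_degree (s + t) (f * g)"
  unfolding monomial_of_degree_def by (auto simp: mult_single exponent_degree_plus)

lemma monomial_of_degree_Var: "monomial_of_degree 1 (Var i)"
  by (auto simp: monomial_of_degree_def Var_def exponent_degree_single)

lemma monomial_of_degree_prod_Var: "monomial_of_degree (card A) (\<Prod>i\<in>A. Var i)"
proof (induction A rule: finite_induct[OF finite])
  case 1
  show ?case by (simp add: monomial_of_degree_one)
next
  case (2 i A)
  then show ?case
    using monomial_of_degree_mult[OF monomial_of_degree_Var 2(3), of i] by simp
qed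

lemma monomial_of_degree_power:
  "monomial_of_degree s f \<Longrightarrow> monomial_of_degree (k * s) (f ^ k)"
  by (induction k) (simp_all add: monomial_of_degree_one monomial_of_degree_mult)

text \<open>This is the \<open>s\<close>-th power of the maximal ideal generated by all variables,
  described through exponents so that membership of a monomial can be read off its degree.\<close>

definition order_ge :: "nat \<Rightarrow> ('v::finite, 'k::field) mpoly set"
  where "order_ge s = {f. \<forall>t\<in>Poly_Mapping.keys f. s \<le> exponent_degree t}"

lemma monomial_in_order_ge:
  "monomial_of_degree s f \<Longrightarrow> f \<in> order_ge r \<longleftrightarrow> r \<le> s"
  by (auto simp: monomial_of_degree_def order_ge_def)

text \<open>Cancellation can only remove terms: every exponent of a product is a sum of exponents of
  the factors, and degrees add.\<close>

lemma order_ge_mult: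
  assumes "f \<in> order_ge r" and "g \<in> order_ge s"
  shows "f * g \<in> order_ge (r + s)"
  unfolding order_ge_def
proof (intro CollectI ballI)
  fix t assume "t \<in> Poly_Mapping.keys (f * g)"
  then obtain a b where "t = a + b" "a \<in> Poly_Mapping.keys f" "b \<in> Poly_Mapping.keys g"
    using keys_mult[of f g] by blast
  with assms show "r + s \<le> exponent_degree t"
    by (auto simp: order_ge_def exponent_degree_plus intro: add_mono)
qed

lemma order_ge_0: "order_ge 0 = UNIV"
  by (simp add: order_ge_def)

lemma subspace_order_ge: "module.subspace (*) (order_ge s)"
proof (rule module.subspaceI[OF module_times])
  show "0 \<in> order_ge s" by (simp add: order_ge_def)
  show "f + g \<in> order_ge s" if "f \<in> order_ge s" "g \<in> order_ge s" for f g
    using that Poly_Mapping.keys_add[of f g] unfolding order_ge_def by blast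
  show "c * f \<in> order_ge s" if "f \<in> order_ge s" for c f
    \<comment> \<open>An arbitrary multiplier has order at least 0.\<close>
    using order_ge_mult[of c 0 f s] that by (simp add: order_ge_0)
qed

text \<open>As \<open>order_ge\<close> is an ideal, checking the generating products suffices, and
  there the orders add up.\<close>

lemma ideal_power_order_ge:
  assumes "I \<subseteq> order_ge r"
  shows "ideal_power I m \<subseteq> order_ge (m * r)"
proof (induction m)
  case 0
  show ?case by (simp add: order_ge_0)
next
  case (Suc m)
  have "{a * b |a b. a \<in> I \<and> b \<in> ideal_power I m} \<subseteq> order_ge (Suc m * r)"
    using assms Suc.IH by (auto intro!: order_ge_mult)
  then show ?case
    by (simp add: ideal_gen_minimal subspace_order_ge)
qed

lemma SR_ideal_order_ge:
  assumes "\<And>\<sigma>. \<sigma> \<notin> \<Delta> \<Longrightarrow> r \<le> card \<sigma>"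
  shows "SR_ideal \<Delta> \<subseteq> order_ge r"
  unfolding SR_ideal_def
  using assms
  by (intro ideal_gen_minimal subspace_order_ge)
    (auto simp: monomial_in_order_ge[OF monomial_of_degree_prod_Var])

text \<open>A set with at most one element lies in some \<open>{i}\<close>, which is a face by the
  convention on vertices.\<close>

lemma card_nonface_ge_2:
  fixes \<Delta> :: "'v::finite set set"
  assumes "simplicial_complex \<Delta>" and "\<sigma> \<notin> \<Delta>"
  shows "2 \<le> card \<sigma>"
proof (rule ccontr)
  assume "\<not> 2 \<le> card \<sigma>"
  then have "card \<sigma> \<le> Suc 0" by simp
  then obtain i where "\<sigma> \<subseteq> {i}"
    by (cases "\<sigma> = {}") (auto simp: card_le_Suc0_iff_eq)
  with assms show False unfolding simplicial_complex_def by blast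
qed

lemma card_face_le:
  fixes \<Delta> :: "'v::finite set set"
  assumes "F \<in> \<Delta>"
  shows "int (card F) \<le> complex_dim \<Delta> + 1"
proof -
  have "face_dim F \<le> complex_dim \<Delta>"
    unfolding complex_dim_def using assms by (intro Max_ge) auto
  then show ?thesis by (simp add: face_dim_def)
qed

theorem proposition1p8:
  fixes \<Delta> :: "'v::finite set set" and d :: int
  assumes "simplicial_complex \<Delta>" and "pure \<Delta>"
    and "d = complex_dim \<Delta> + 1"
    and "\<exists>m::nat. int m \<ge> d + 1 \<and>
      (SR_symbolic_power \<Delta> m :: ('v, 'k::field) mpoly set) = ideal_power (SR_ideal \<Delta>) m"
  shows "int CARD('v) \<le> 2 * d"
proof (rule ccontr)
  assume large: "\<not> int CARD('v) \<le> 2 * d"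
  obtain m where m: "int m \<ge> d + 1"
    and eq: "(SR_symbolic_power \<Delta> m :: ('v, 'k) mpoly set) = ideal_power (SR_ideal \<Delta>) m"
    using assms(4) by blast
  have face_card: "int (card F) \<le> d" if "F \<in> \<Delta>" for F
    using card_face_le[OF that] assms(3) by simp
  \<comment> \<open>Types are inhabited, so \<open>undefined\<close> serves as a vertex; its
    singleton is a face, which makes \<open>d\<close> positive and hence a natural number
    \<open>e\<close>.\<close>
  have "int (card {undefined :: 'v}) \<le> d"
    using assms(1) by (intro face_card) (auto simp: simplicial_complex_def)
  then obtain e where d: "d = int e"
    by (metis of_nat_0_le_iff order_trans zero_le_imp_eq_int)
  have "2 * e + 1 \<le> CARD('v)" using large d by linarith
  then obtain W :: "'v set" where W: "card W = 2 * e + 1"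
    by (metis obtain_subset_with_card_n)
  \<comment> \<open>The full vertex set has more than \<open>d\<close> elements, so nonfaces exist
    and a smallest one can be chosen.\<close>
  have "UNIV \<notin> \<Delta>" using face_card[of UNIV] large d by auto
  then obtain G where G: "G \<notin> \<Delta>" and G_min: "\<And>\<sigma>. \<sigma> \<notin> \<Delta> \<Longrightarrow> card G \<le> card \<sigma>"
    using ex_has_least_nat[of "\<lambda>\<sigma>. \<sigma> \<notin> \<Delta>" UNIV card] by blast
  \<comment> \<open>The bound \<open>m \<ge> d + 1\<close> makes this truncated subtraction
    exact.\<close>
  define k where "k = m - (e + 1)"
  have m_eq: "m = k + (e + 1)" using m d by (simp add: k_def)
  define u :: "('v, 'k) mpoly" where "u = (\<Prod>i\<in>G. Var i) ^ k * (\<Prod>i\<in>W. Var i)"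
  have "u \<in> ideal_power (facet_prime F) m" if "F \<in> facets \<Delta>" for F
  proof -
    have F: "F \<in> \<Delta>" using that by (simp add: facets_def)
    \<comment> \<open>A face has at most \<open>e\<close> elements, so it leaves at least
      \<open>(2 * e + 1) - e\<close> elements of \<open>W\<close> uncovered.\<close>
    then have "e + 1 \<le> card (W - F)"
      using face_card[OF F] d W diff_card_le_card_Diff[of F W] by simp
    then have "(\<Prod>i\<in>W. Var i :: ('v, 'k) mpoly) \<in> ideal_power (facet_prime F) (e + 1)"
      using prod_Var_in_facet_prime_power ideal_power_antimono by blast
    \<comment> \<open>\<open>G\<close> is not contained in \<open>F\<close>, because subsets of
      faces are faces.\<close>
    moreover have "(\<Prod>i\<in>G. Var i :: ('v, 'k) mpoly) \<in> facet_prime F"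
      using F G assms(1) by (intro prod_Var_in_facet_prime) (auto simp: simplicial_complex_def)
    ultimately show ?thesis
      unfolding u_def m_eq by (intro ideal_power_power_mult)
  qed
  then have "u \<in> ideal_power (SR_ideal \<Delta>) m"
    unfolding eq[symmetric] SR_symbolic_power_def by blast
  then have "u \<in> order_ge (m * card G)"
    using ideal_power_order_ge[OF SR_ideal_order_ge[OF G_min]] by blast
  moreover have "monomial_of_degree (k * card G + (2 * e + 1)) u"
    unfolding u_def W[symmetric]
    by (intro monomial_of_degree_mult monomial_of_degree_power monomial_of_degree_prod_Var)
  ultimately have "m * card G \<le> k * card G + (2 * e + 1)"
    by (simp add: monomial_in_order_ge)
  \<comment> \<open>The powers of the nonface monomial cancel from both sides;
    \<open>card G \<ge> 2\<close> then forces \<open>2 * e + 2 \<le> 2 * e + 1\<close>.\<close>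
  then have "(e + 1) * card G \<le> 2 * e + 1"
    by (simp add: m_eq add_mult_distrib)
  moreover have "(e + 1) * 2 \<le> (e + 1) * card G"
    using card_nonface_ge_2[OF assms(1) G] by (rule mult_le_mono2)
  ultimately show False by simp
qed

end
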